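(* Let $L\ge1$ be an integer. Let $g_d,g_1,\dots,g_L$ be mutually independent random variables such that $g_d$ is a unit-mean $\kappa$-$\mu$ power random variable with parameters $(\kappa,\mu)$ and $g_1,\dots,g_L$ are identically distributed unit-mean $\kappa$-$\mu$ power random variables with parameters $(\kappa_I,\mu_I)$ (all parameters positive reals). Suppose $\mu>0.5$. Then the interference-limited error vector magnitude $\mathrm{EVM}=\mathbb{E}\left[\sqrt{\left(\sum_{l=1}^L g_l\right)/g_d}\right]$ equals $$\frac{\Gamma(\mu-0.5)\,\Gamma(L\mu_I+0.5)}{\Gamma(L\mu_I)\,\Gamma(\mu)}\;{}_1F_1(0.5;\,\mu;\,-\kappa\mu)\;{}_1F_1(-0.5;\,L\mu_I;\,-L\kappa_I\mu_I)\;\sqrt{\frac{\mu(1+\kappa)}{\mu_I(1+\kappa_I)}}.$$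
   Context: Unit-mean $\kappa$-$\mu$ power random variable with parameters $(\kappa,\mu)$, $\kappa,\mu>0$: a positive random variable with density $$f(x)=\frac{\mu(1+\kappa)^{\frac{\mu+1}{2}}}{\kappa^{\frac{\mu-1}{2}}e^{\mu\kappa}}\,x^{\frac{\mu-1}{2}}e^{-\mu(1+\kappa)x}\,I_{\mu-1}\!\left(2\mu\sqrt{\kappa(1+\kappa)x}\right),\quad x>0,$$ where $I_\nu$ is the modified Bessel function of the first kind. (This is the $m\to\infty$ limit of the unit-mean $\kappa$-$\mu$ shadowed power density $\frac{\theta_1^{m-\mu}x^{\mu-1}}{\theta_2^m\Gamma(\mu)}e^{-x/\theta_1}{}_1F_1\left(m;\mu;\frac{(\theta_2-\theta_1)x}{\theta_1\theta_2}\right)$ with $\theta_1=\frac{1}{\mu(1+\kappa)}$, $\theta_2=\frac{\mu\kappa+m}{\mu(1+\kappa)m}$.) EVM: a desired signal with fading power $g_d$ is received together with $L$ interferers with fading powers $g_1,\dots,g_L$; with unit symbol energy, and in the absence of noise (interference-limited system), the error vector magnitude is $\mathrm{EVM}=\mathbb{E}\left[\sqrt{\left(\sum_{l=1}^L g_l\right)/g_d}\right]$. ${}_1F_1$ is Kummer's confluent hypergeometric function. *)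

theory Defs
  imports "HOL-Probability.Probability"
begin

definition kummer_1F1 :: "real \<Rightarrow> real \<Rightarrow> real \<Rightarrow> real" where
  "kummer_1F1 a b z = eval_fps (fps_hypergeo [a] [b] 1) z"

lemma kummer_1F1_altdef:
  "kummer_1F1 a b z = (\<Sum>n. pochhammer a n / pochhammer b n * z ^ n / fact n)"
  by (simp add: kummer_1F1_def eval_fps_def)

text \<open>
  Modified Bessel function of the first kind, for a real argument \<open>x > 0\<close>; \<open>rGamma\<close> is the
  reciprocal Gamma function. At \<open>x = 0\<close> the formula yields 0 because of \<open>0 powr a = 0\<close>, which
  is the wrong value for \<open>\<nu> = 0\<close>.
\<close>
definition bessel_I :: "real \<Rightarrow> real \<Rightarrow> real" where
  "bessel_I \<nu> x = (\<Sum>k. rGamma (\<nu> + real k + 1) / fact k * (x / 2) powr (\<nu> + 2 * real k))"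

definition kappa_mu_power_density :: "real \<Rightarrow> real \<Rightarrow> real \<Rightarrow> real" where
  "kappa_mu_power_density \<kappa> \<mu> x =
     (if x > 0 then
        \<mu> * (1 + \<kappa>) powr ((\<mu> + 1) / 2) / (\<kappa> powr ((\<mu> - 1) / 2) * exp (\<mu> * \<kappa>))
          * x powr ((\<mu> - 1) / 2) * exp (- \<mu> * (1 + \<kappa>) * x)
          * bessel_I (\<mu> - 1) (2 * \<mu> * sqrt (\<kappa> * (1 + \<kappa>) * x))
      else 0)"

text \<open>
  Positivity of the random variable is only required almost surely: the density vanishes on the
  nonpositive half-line.
\<close>
definition kappa_mu_power_rv :: "'a measure \<Rightarrow> ('a \<Rightarrow> real) \<Rightarrow> real \<Rightarrow> real \<Rightarrow> bool" where
  "kappa_mu_power_rv M X \<kappa> \<mu> \<longleftrightarrow>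
     distributed M lborel X (\<lambda>x. ennreal (kappa_mu_power_density \<kappa> \<mu> x))"

definition error_vector :: "nat \<Rightarrow> ('a \<Rightarrow> real) \<Rightarrow> (nat \<Rightarrow> 'a \<Rightarrow> real) \<Rightarrow> 'a \<Rightarrow> real" where
  "error_vector L gd g \<omega> = sqrt ((\<Sum>l=1..L. g l \<omega>) / gd \<omega>)"

definition EVM :: "'a measure \<Rightarrow> nat \<Rightarrow> ('a \<Rightarrow> real) \<Rightarrow> (nat \<Rightarrow> 'a \<Rightarrow> real) \<Rightarrow> real" where
  "EVM M L gd g = prob_space.expectation M (error_vector L gd g)"

end

theory Submission
  imports Defs
begin

text \<open>
  Expanding the Bessel function shows that the \<open>\<kappa>\<close>-\<open>\<mu>\<close> power density is a mixture, over a
  Poisson variable \<open>k\<close> of mean \<open>\<mu>\<kappa>\<close>, of gamma densities of shape \<open>\<mu> + k\<close> and rate \<open>\<mu>(1 + \<kappa>)\<close>.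
  For a common rate such mixtures are closed under convolution, with shapes and Poisson means
  adding up, so the interference is again of this type. Integrating termwise, the moment of order
  \<open>s\<close> of a mixture with shape \<open>m\<close> and Poisson mean \<open>r\<close> is a multiple of \<open>exp (- r)\<close> times
  \<open>1F1(m + s; m; r)\<close>, which Kummer's transformation turns into \<open>1F1(- s; m; - r)\<close>. By independence
  the error vector magnitude is the product of the moment of order \<open>1/2\<close> of the interference and
  that of order \<open>- 1/2\<close> of the desired signal.
\<close>

section \<open>Series and Kummer's transformation\<close>

text \<open>Ratio test in recurrence form: \<open>f (Suc n)\<close> is a multiple of
  \<open>f n\<close>, so no quotient of terms is formed and terms may vanish, as they do in a
  terminating hypergeometric series.\<close>

lemma summable_norm_ratio_tendsto_0:
  fixes f :: "nat \<Rightarrow> real"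
  assumes step: "\<And>n. f (Suc n) = r n * f n" and lim: "r \<longlonglongrightarrow> 0"
  shows "summable (\<lambda>n. norm (f n))"
proof -
  from lim have "eventually (\<lambda>n. norm (r n) < 1/2) sequentially"
    by (auto simp: tendsto_iff dist_norm dest: spec[of _ "1/2"])
  then obtain N where N: "\<And>n. n \<ge> N \<Longrightarrow> norm (r n) < 1/2"
    by (auto simp: eventually_sequentially)
  show ?thesis
  proof (rule summable_ratio_test[of "1/2" N])
    fix n assume "n \<ge> N"
    from N[OF this] show "norm (norm (f (Suc n))) \<le> 1/2 * norm (norm (f n))"
      unfolding step using mult_right_mono[of "norm (r n)" "1/2" "norm (f n)"] by (simp add: abs_mult)
  qed simp
qed

lemma suminf_swap_ennreal:
  fixes f :: "nat \<Rightarrow> nat \<Rightarrow> ennreal"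
  shows "(\<Sum>i. \<Sum>j. f i j) = (\<Sum>j. \<Sum>i. f i j)"
  using nn_integral_suminf[of "\<lambda>i j. f j i" "count_space UNIV"]
  by (simp add: nn_integral_count_space_nat)

text \<open>Row \<open>i\<close> is shifted right by \<open>i\<close> places and padded with zeros.
  After exchanging the sums, column \<open>n\<close> contains exactly the finite diagonal on which
  the indices add up to \<open>n\<close>.\<close>

lemma suminf_diagonals_ennreal:
  fixes f :: "nat \<Rightarrow> nat \<Rightarrow> ennreal"
  shows "(\<Sum>i. \<Sum>j. f i j) = (\<Sum>n. \<Sum>i\<le>n. f i (n - i))"
proof -
  have shift: "(\<Sum>n. if i \<le> n then f i (n - i) else 0) = (\<Sum>j. f i j)" for i
    by (subst suminf_offset[where i = i]) (auto simp: summableI)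
  have "(\<Sum>i\<le>n. f i (n - i)) = (\<Sum>i. if i \<le> n then f i (n - i) else 0)" for n
    by (subst suminf_finite[of "{..n}"]) auto
  then show ?thesis
    using suminf_swap_ennreal[of "\<lambda>i n. if i \<le> n then f i (n - i) else 0"] shift by simp
qed

lemma summable_kummer_1F1:
  fixes a b z :: real
  assumes "b > 0"
  shows "summable (\<lambda>n. norm (pochhammer a n / pochhammer b n * z ^ n / fact n))"
proof (rule summable_norm_ratio_tendsto_0)
  fix n
  show "pochhammer a (Suc n) / pochhammer b (Suc n) * z ^ Suc n / fact (Suc n) =
    ((a + real n) / (b + real n) * z / (real n + 1)) * (pochhammer a n / pochhammer b n * z ^ n / fact n)"
    using assms by (simp add: pochhammer_Suc add.commute mult_ac)
next
  show "(\<lambda>n. (a + real n) / (b + real n) * z / (real n + 1)) \<longlonglongrightarrow> 0"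
    by real_asymp
qed

text \<open>Multiply the exponential series by the hypergeometric one. Each coefficient of the
  Cauchy product is a terminating 2F1 at 1, which the Chu-Vandermonde identity evaluates.\<close>

lemma kummer_transformation:
  fixes a b z :: real
  assumes b: "b > 0"
  shows "exp (- z) * kummer_1F1 (b - a) b z = kummer_1F1 a b (- z)"
proof -
  define f where "f n = pochhammer (b - a) n / pochhammer b n * z ^ n / fact n" for n
  define g where "g n = (- z) ^ n / fact n" for n
  have coeff: "(\<Sum>i\<le>n. f i * g (n - i)) = pochhammer a n / pochhammer b n * (- z) ^ n / fact n" for n
  proof -
    \<comment> \<open>Expressing \<open>1 / fact (n - i)\<close> through
      \<open>pochhammer (- real n) i\<close> gives the summand the shape of
      \<open>Vandermonde_pochhammer\<close>. The sign this introduces is absorbed by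
      \<open>(- z) ^ n\<close>.\<close>
    have "f i * g (n - i) = (- z) ^ n / fact n *
        (pochhammer (b - a) i * pochhammer (- real n) i / (of_nat (fact i) * pochhammer b i))"
      if "i \<le> n" for i
    proof -
      have "pochhammer (- real n) i = (- 1) ^ i * (fact n / fact (n - i))"
      proof -
        have "real (n choose i) = (- 1) ^ i * pochhammer (- real n) i / fact i"
          by (simp add: binomial_gbinomial gbinomial_pochhammer)
        then have "pochhammer (- real n) i = (- 1) ^ i * (fact i * real (n choose i))"
          by (simp add: field_simps flip: power_mult_distrib)
        also have "fact i * real (n choose i) = fact n / fact (n - i)"
          using that by (simp add: binomial_fact)
        finally show ?thesis .
      qed
      moreover have "(- z) ^ n * (- 1) ^ i = z ^ i * (- z) ^ (n - i)"
      proof -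
        have "(- z) ^ n = (- z) ^ i * (- z) ^ (n - i)"
          using that by (simp flip: power_add)
        moreover have "(- z) ^ i * (- 1) ^ i = z ^ i"
          by (simp flip: power_mult_distrib)
        ultimately show ?thesis
          by (simp add: mult.commute mult.left_commute)
      qed
      ultimately have "(- z) ^ n / fact n *
          (pochhammer (b - a) i * pochhammer (- real n) i / (of_nat (fact i) * pochhammer b i)) =
          pochhammer (b - a) i / pochhammer b i * (z ^ i * (- z) ^ (n - i)) / (fact i * fact (n - i))"
        by (simp add: mult_ac)
      then show ?thesis
        by (simp add: f_def g_def)
    qed
    then have "(\<Sum>i\<le>n. f i * g (n - i)) = (- z) ^ n / fact n *
        (\<Sum>i=0..n. pochhammer (b - a) i * pochhammer (- real n) i / (of_nat (fact i) * pochhammer b i))"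
      by (simp add: sum_distrib_left atMost_atLeast0)
    also have "\<dots> = (- z) ^ n / fact n * (pochhammer a n / pochhammer b n)"
      using b by (subst Vandermonde_pochhammer) auto
    finally show ?thesis by (simp add: mult.commute)
  qed
  have "summable (\<lambda>n. norm (f n))"
    unfolding f_def by (rule summable_kummer_1F1[OF b])
  moreover have "summable (\<lambda>n. norm (g n))"
    using summable_norm_exp[of "- z"] by (simp add: g_def field_simps)
  ultimately have "(\<Sum>n. f n) * (\<Sum>n. g n) = (\<Sum>n. \<Sum>i\<le>n. f i * g (n - i))"
    by (rule Cauchy_product)
  moreover have "(\<Sum>n. g n) = exp (- z)"
    by (simp add: g_def exp_def field_simps)
  moreover have "kummer_1F1 (b - a) b z = (\<Sum>n. f n)"
    by (simp add: kummer_1F1_altdef f_def)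
  ultimately show ?thesis
    by (simp only: kummer_1F1_altdef[of a] coeff mult.commute[of "exp (- z)"])
qed

section \<open>Gamma densities\<close>

definition gamma_density :: "real \<Rightarrow> real \<Rightarrow> real \<Rightarrow> real" where
  "gamma_density a \<beta> x = (if x > 0 then \<beta> powr a / Gamma a * x powr (a - 1) * exp (- \<beta> * x) else 0)"

lemma gamma_density_nonneg: "a > 0 \<Longrightarrow> gamma_density a \<beta> x \<ge> 0"
  by (simp add: gamma_density_def Gamma_real_pos less_imp_le)

lemma measurable_gamma_density [measurable]: "gamma_density a \<beta> \<in> borel_measurable borel"
  unfolding gamma_density_def by measurable

lemma nn_integral_gamma_density_powr:
  assumes a: "a > 0" "a + s > 0" and \<beta>: "\<beta> > 0"
  shows "(\<integral>\<^sup>+x. ennreal (gamma_density a \<beta> x) * ennreal (x powr s) \<partial>lborel) =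
    ennreal (\<beta> powr (- s) * Gamma (a + s) / Gamma a)"
proof -
  let ?K = "\<beta> powr (1 - s) / Gamma a"
  have Gpos: "Gamma a > 0" "Gamma (a + s) > 0"
    using a by (simp_all add: Gamma_real_pos)
  have "(\<integral>\<^sup>+x. ennreal (gamma_density a \<beta> x) * ennreal (x powr s) \<partial>lborel) =
    ennreal (1 / \<beta>) * (\<integral>\<^sup>+u. ennreal (gamma_density a \<beta> (u / \<beta>)) * ennreal ((u / \<beta>) powr s) \<partial>lborel)"
    using \<beta> by (subst nn_integral_real_affine[where c = "1 / \<beta>" and t = 0]) auto
  also have "(\<integral>\<^sup>+u. ennreal (gamma_density a \<beta> (u / \<beta>)) * ennreal ((u / \<beta>) powr s) \<partial>lborel) =
    (\<integral>\<^sup>+u. ennreal ?K * ennreal (indicator {0..} u * u powr (a + s - 1) / exp u) \<partial>lborel)"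
  proof (intro nn_integral_cong)
    fix u :: real
    show "ennreal (gamma_density a \<beta> (u / \<beta>)) * ennreal ((u / \<beta>) powr s) =
      ennreal ?K * ennreal (indicator {0..} u * u powr (a + s - 1) / exp u)"
    proof (cases "u > 0")
      case True
      have "gamma_density a \<beta> (u / \<beta>) * (u / \<beta>) powr s =
          \<beta> powr a / Gamma a * ((u / \<beta>) powr (a - 1) * (u / \<beta>) powr s) / exp u"
        using True \<beta> by (simp add: gamma_density_def exp_minus divide_inverse)
      also have "(u / \<beta>) powr (a - 1) * (u / \<beta>) powr s = u powr (a + s - 1) / \<beta> powr (a + s - 1)"
        using True \<beta> by (simp add: algebra_simps flip: powr_add powr_divide)
      also have "\<beta> powr a / Gamma a * \<dots> / exp u =
          (\<beta> powr a / \<beta> powr (a + s - 1)) / Gamma a * (u powr (a + s - 1) / exp u)"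
        by simp
      also have "\<beta> powr a / \<beta> powr (a + s - 1) = \<beta> powr (1 - s)"
        by (simp flip: powr_diff)
      finally have "gamma_density a \<beta> (u / \<beta>) * (u / \<beta>) powr s =
          ?K * (indicator {0..} u * u powr (a + s - 1) / exp u)"
        using True by simp
      then show ?thesis
        using Gpos True by (simp flip: ennreal_mult'')
    next
      \<comment> \<open>At \<open>u = 0\<close> the indicator is 1, but \<open>0 powr _ = 0\<close>
        makes the right-hand side vanish there too.\<close>
      case False
      then show ?thesis
        using \<beta> by (cases "u = 0") (auto simp: gamma_density_def zero_less_divide_iff)
    qed
  qed
  also have "\<dots> = ennreal ?K * ennreal (Gamma (a + s))"
    using a by (simp add: nn_integral_cmult Gamma_conv_nn_integral_real)
  also have "ennreal (1 / \<beta>) * (ennreal ?K * ennreal (Gamma (a + s))) =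
      ennreal (\<beta> powr (- s) * Gamma (a + s) / Gamma a)"
    using \<beta> Gpos by (simp add: powr_diff powr_minus field_simps flip: ennreal_mult)
  finally show ?thesis .
qed

text \<open>The substitution \<open>y = x * t\<close> separates \<open>x\<close> from
  \<open>t\<close> and leaves Euler's Beta integral in \<open>t\<close>. The exponentials merge
  because both densities have the same rate.\<close>

lemma convolution_gamma_density:
  assumes ab: "a > 0" "b > 0" and \<beta>: "\<beta> > 0"
  shows "(\<integral>\<^sup>+y. ennreal (gamma_density a \<beta> (x - y)) * ennreal (gamma_density b \<beta> y) \<partial>lborel) =
    ennreal (gamma_density (a + b) \<beta> x)"
proof (cases "x > 0")
  case False
  then have "(\<lambda>y. ennreal (gamma_density a \<beta> (x - y)) * ennreal (gamma_density b \<beta> y)) = (\<lambda>_. 0)"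
    by (auto simp: gamma_density_def)
  with False show ?thesis
    by (simp only:) (simp add: gamma_density_def)
next
  case x: True
  let ?K = "\<beta> powr (a + b) / (Gamma a * Gamma b) * x powr (a + b - 2) * exp (- \<beta> * x)"
  have Gpos: "Gamma a > 0" "Gamma b > 0" "Gamma (a + b) > 0"
    using ab by (simp_all add: Gamma_real_pos)
  have "(\<integral>\<^sup>+y. ennreal (gamma_density a \<beta> (x - y)) * ennreal (gamma_density b \<beta> y) \<partial>lborel) =
    ennreal x * (\<integral>\<^sup>+t. ennreal (gamma_density a \<beta> (x - x * t)) * ennreal (gamma_density b \<beta> (x * t)) \<partial>lborel)"
    using x by (subst nn_integral_real_affine[where c = x and t = 0]) auto
  also have "(\<integral>\<^sup>+t. ennreal (gamma_density a \<beta> (x - x * t)) * ennreal (gamma_density b \<beta> (x * t)) \<partial>lborel) =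
    (\<integral>\<^sup>+t. ennreal ?K * ennreal (indicator {0..1} t * (t powr (b - 1) * (1 - t) powr (a - 1))) \<partial>lborel)"
  proof (intro nn_integral_cong)
    fix t :: real
    have eq: "x - x * t = x * (1 - t)"
      by (simp add: algebra_simps)
    show "ennreal (gamma_density a \<beta> (x - x * t)) * ennreal (gamma_density b \<beta> (x * t)) =
      ennreal ?K * ennreal (indicator {0..1} t * (t powr (b - 1) * (1 - t) powr (a - 1)))"
    proof (cases "0 < t \<and> t < 1")
      case True
      have "exp (- \<beta> * (x * (1 - t))) * exp (- \<beta> * (x * t)) = exp (- \<beta> * x)"
        by (simp add: algebra_simps flip: exp_add)
      moreover have "x powr (a - 1) * x powr (b - 1) = x powr (a + b - 2)"
        using x by (simp flip: powr_add)
      moreover have "gamma_density a \<beta> (x * (1 - t)) * gamma_density b \<beta> (x * t) =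
        \<beta> powr (a + b) / (Gamma a * Gamma b) * (x powr (a - 1) * x powr (b - 1)) *
        (exp (- \<beta> * (x * (1 - t))) * exp (- \<beta> * (x * t))) * (t powr (b - 1) * (1 - t) powr (a - 1))"
        using True x by (simp add: gamma_density_def powr_mult powr_add)
      ultimately have "gamma_density a \<beta> (x * (1 - t)) * gamma_density b \<beta> (x * t) =
        ?K * (indicator {0..1} t * (t powr (b - 1) * (1 - t) powr (a - 1)))"
        using True by simp
      then show ?thesis
        using ab unfolding eq by (simp add: gamma_density_nonneg flip: ennreal_mult'')
    next
      \<comment> \<open>Outside the unit interval one of the two densities is 0; at its endpoints
        both sides are 0 because of \<open>0 powr _ = 0\<close>.\<close>
      case False
      then show ?thesis
        using x unfolding eq by (cases "t = 0 \<or> t = 1") (auto simp: gamma_density_def zero_less_mult_iff)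
    qed
  qed
  also have "\<dots> = ennreal ?K * ennreal (Beta b a)"
    using ab by (subst nn_integral_cmult)
      (simp_all add: nn_integral_has_integral_lebesgue[OF _ has_integral_Beta_real])
  also have "ennreal x * (ennreal ?K * ennreal (Beta b a)) = ennreal (gamma_density (a + b) \<beta> x)"
  proof -
    \<comment> \<open>The Jacobian \<open>x\<close> of the substitution supplies the missing
      power.\<close>
    have "x powr (a + b - 1) = x * x powr (a + b - 2)"
      using x powr_add[of x 1 "a + b - 2"] by simp
    then have "x * (?K * Beta b a) = gamma_density (a + b) \<beta> x"
      using x Gpos by (simp add: gamma_density_def Beta_def add.commute[of b a])
    then show ?thesis
      using x Gpos by (simp add: Beta_def add.commute[of b a] flip: ennreal_mult'')
  qed
  finally show ?thesis .
qed

section \<open>Poisson mixtures of gamma densities\<close>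

text \<open>For positive parameters this is a noncentral chi-square density with
  \<open>2 * m\<close> degrees of freedom and noncentrality \<open>2 * r\<close>, for the variable
  divided by \<open>2 * \<beta>\<close>. Values in \<open>ennreal\<close> let sums and integrals be
  exchanged freely.\<close>

definition poisson_gamma_density :: "real \<Rightarrow> real \<Rightarrow> real \<Rightarrow> real \<Rightarrow> ennreal" where
  "poisson_gamma_density m r \<beta> x =
    (\<Sum>k. ennreal (r ^ k / fact k * exp (- r)) * ennreal (gamma_density (m + real k) \<beta> x))"

lemma measurable_poisson_gamma_density [measurable]:
  "poisson_gamma_density m r \<beta> \<in> borel_measurable borel"
  unfolding poisson_gamma_density_def by measurable

lemma poisson_gamma_density_nonpos: "x \<le> 0 \<Longrightarrow> poisson_gamma_density m r \<beta> x = 0"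
  by (simp add: poisson_gamma_density_def gamma_density_def)

text \<open>The functional equation of \<open>rGamma\<close> gives a term ratio of order
  \<open>1 / k^2\<close>. The range \<open>\<nu> > - 1\<close> covers the index
  \<open>\<mu> - 1\<close> for every positive \<mu>.\<close>

lemma summable_bessel_I:
  assumes "\<nu> > - 1" "x > 0"
  shows "summable (\<lambda>k. rGamma (\<nu> + real k + 1) / fact k * (x / 2) powr (\<nu> + 2 * real k))"
proof (rule summable_norm_cancel, rule summable_norm_ratio_tendsto_0)
  fix k
  have "rGamma (\<nu> + real k + 1) = (\<nu> + real k + 1) * rGamma (\<nu> + real (Suc k) + 1)"
    using rGamma_plus1[of "\<nu> + real k + 1"] by (simp add: algebra_simps)
  moreover have "(x / 2) powr (\<nu> + 2 * real (Suc k)) = (x / 2)\<^sup>2 * (x / 2) powr (\<nu> + 2 * real k)"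
    using assms by (simp add: distrib_left powr_add powr_numeral flip: add.assoc)
  moreover have "\<nu> + real k + 1 > 0"
    using assms by simp
  ultimately show "rGamma (\<nu> + real (Suc k) + 1) / fact (Suc k) * (x / 2) powr (\<nu> + 2 * real (Suc k)) =
      ((x / 2)\<^sup>2 / ((real k + 1) * (\<nu> + real k + 1))) *
      (rGamma (\<nu> + real k + 1) / fact k * (x / 2) powr (\<nu> + 2 * real k))"
    by (simp add: add.commute)
next
  show "(\<lambda>k. (x / 2)\<^sup>2 / ((real k + 1) * (\<nu> + real k + 1))) \<longlonglongrightarrow> 0"
    by real_asymp
qed

text \<open>The match is term by term: the prefactor \<open>C\<close> times the \<open>k\<close>-th
  Bessel term is the \<open>k\<close>-th Poisson weight times the gamma density of shape
  \<open>\<mu> + k\<close>.\<close>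

lemma kappa_mu_power_density_conv_poisson_gamma:
  assumes \<kappa>: "\<kappa> > 0" and \<mu>: "\<mu> > 0"
  shows "ennreal (kappa_mu_power_density \<kappa> \<mu> x) = poisson_gamma_density \<mu> (\<mu> * \<kappa>) (\<mu> * (1 + \<kappa>)) x"
proof (cases "x > 0")
  case False
  then show ?thesis
    by (simp add: kappa_mu_power_density_def poisson_gamma_density_nonpos)
next
  case x: True
  define q where "q = 1 + \<kappa>"
  have q: "q > 0"
    using \<kappa> by (simp add: q_def)
  define y where "y = 2 * \<mu> * sqrt (\<kappa> * q * x)"
  define C where "C = \<mu> * q powr ((\<mu> + 1) / 2) / (\<kappa> powr ((\<mu> - 1) / 2) * exp (\<mu> * \<kappa>))
      * x powr ((\<mu> - 1) / 2) * exp (- \<mu> * q * x)"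
  define t where "t k = rGamma (\<mu> - 1 + real k + 1) / fact k * (y / 2) powr (\<mu> - 1 + 2 * real k)" for k
  have y: "y > 0"
    using \<kappa> \<mu> q x by (simp add: y_def)
  have "summable t"
    unfolding t_def using \<mu> y by (intro summable_bessel_I) auto
  have terms: "C * t k = (\<mu> * \<kappa>) ^ k / fact k * exp (- (\<mu> * \<kappa>)) * gamma_density (\<mu> + real k) (\<mu> * q) x" for k
  proof -
    let ?h = "(\<mu> - 1) / 2"
    have "(y / 2) powr (\<mu> - 1 + 2 * real k) = \<mu> powr (\<mu> - 1 + 2 * real k) * sqrt (\<kappa> * q * x) powr (\<mu> - 1 + 2 * real k)"
      using \<mu> by (simp add: y_def powr_mult)
    also have "sqrt (\<kappa> * q * x) powr (\<mu> - 1 + 2 * real k) = (\<kappa> * q * x) powr (?h + real k)"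
      using \<kappa> q x by (simp add: powr_half_sqrt[symmetric] powr_powr add_divide_distrib)
    also have "\<dots> = \<kappa> powr (?h + real k) * q powr (?h + real k) * x powr (?h + real k)"
      using \<kappa> q x by (simp add: powr_mult)
    finally have y_powr: "(y / 2) powr (\<mu> - 1 + 2 * real k) = \<mu> powr (\<mu> - 1 + 2 * real k) *
        (\<kappa> powr (?h + real k) * q powr (?h + real k) * x powr (?h + real k))" .
    \<comment> \<open>Groups the factors by base, so that the powers of \<mu>, \<kappa>,
      \<open>q\<close> and \<open>x\<close> can be merged one base at a time.\<close>
    have rearrange: "M * A / (B * E) * X * E' * (R / F * (P * (B' * A' * X'))) =
        R / F * (1 / E) * E' * (M * P) * (B' / B) * (A * A') * (X * X')"
      for M A B E X E' R F P B' A' X' :: real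
      by (simp add: mult_ac)
    have "C * t k = rGamma (\<mu> + real k) / fact k * (1 / exp (\<mu> * \<kappa>)) * exp (- \<mu> * q * x) *
        (\<mu> * \<mu> powr (\<mu> - 1 + 2 * real k)) * (\<kappa> powr (?h + real k) / \<kappa> powr ?h) *
        (q powr ((\<mu> + 1) / 2) * q powr (?h + real k)) * (x powr ?h * x powr (?h + real k))"
      unfolding C_def t_def y_powr rearrange by simp
    \<comment> \<open>The exponent splits in two: \<open>k\<close> goes to the Poisson weight,
      \<open>\<mu> + k\<close> to the rate factor of the gamma density.\<close>
    also have "\<mu> * \<mu> powr (\<mu> - 1 + 2 * real k) = \<mu> ^ k * \<mu> powr (\<mu> + real k)"
    proof -
      have "\<mu> * \<mu> powr (\<mu> - 1 + 2 * real k) = \<mu> powr 1 * \<mu> powr (\<mu> - 1 + 2 * real k)"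
        using \<mu> by simp
      also have "\<dots> = \<mu> powr (real k + (\<mu> + real k))"
        by (simp only: powr_add[symmetric]) (simp add: add.commute)
      finally show ?thesis
        using \<mu> by (simp only: powr_add[of _ "real k"] powr_realpow)
    qed
    also have "\<kappa> powr (?h + real k) / \<kappa> powr ?h = \<kappa> ^ k"
      using \<kappa> by (simp add: powr_add powr_realpow)
    also have "q powr ((\<mu> + 1) / 2) * q powr (?h + real k) = q powr (\<mu> + real k)"
      by (simp add: add_divide_distrib diff_divide_distrib flip: powr_add)
    also have "x powr ?h * x powr (?h + real k) = x powr (\<mu> + real k - 1)"
      unfolding powr_add[symmetric] by (rule arg_cong[where f = "(powr) x"]) (simp add: field_simps)
    finally have "C * t k = rGamma (\<mu> + real k) / fact k * (1 / exp (\<mu> * \<kappa>)) * exp (- \<mu> * q * x) *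
        (\<mu> ^ k * \<mu> powr (\<mu> + real k)) * \<kappa> ^ k * q powr (\<mu> + real k) * x powr (\<mu> + real k - 1)" .
    moreover have "rGamma (\<mu> + real k) = 1 / Gamma (\<mu> + real k)"
      by (simp add: rGamma_inverse_Gamma divide_inverse)
    moreover have "(\<mu> * q) powr (\<mu> + real k) = \<mu> powr (\<mu> + real k) * q powr (\<mu> + real k)"
      using \<mu> q by (simp add: powr_mult)
    moreover have "exp (- (\<mu> * \<kappa>)) = 1 / exp (\<mu> * \<kappa>)"
      by (simp add: exp_minus divide_inverse)
    ultimately show ?thesis
      using x by (simp add: gamma_density_def power_mult_distrib mult.commute mult.left_commute)
  qed
  have "kappa_mu_power_density \<kappa> \<mu> x = C * bessel_I (\<mu> - 1) y"
    using x by (simp add: kappa_mu_power_density_def C_def y_def q_def)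
  also have "\<dots> = (\<Sum>k. C * t k)"
    unfolding bessel_I_def t_def[symmetric] using \<open>summable t\<close> by (simp add: suminf_mult)
  finally have "ennreal (kappa_mu_power_density \<kappa> \<mu> x) = ennreal (\<Sum>k. C * t k)"
    by simp
  also have "\<dots> = (\<Sum>k. ennreal (C * t k))"
  proof (rule suminf_ennreal2[symmetric])
    show "0 \<le> C * t k" for k
      using \<kappa> \<mu> by (simp add: terms gamma_density_nonneg)
    show "summable (\<lambda>k. C * t k)"
      using \<open>summable t\<close> by (rule summable_mult)
  qed
  also have "\<dots> = poisson_gamma_density \<mu> (\<mu> * \<kappa>) (\<mu> * (1 + \<kappa>)) x"
    unfolding poisson_gamma_density_def terms q_def using \<kappa> \<mu>
    by (intro suminf_cong ennreal_mult gamma_density_nonneg) auto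
  finally show ?thesis .
qed

text \<open>The moments of the components differ from the one at \<open>k = 0\<close> by a quotient
  of Pochhammer symbols, so the Poisson-weighted sum is a 1F1 series with upper parameter
  \<open>m + s\<close>.\<close>

lemma nn_integral_poisson_gamma_density_powr:
  assumes m: "m > 0" "m + s > 0" and r: "r \<ge> 0" and \<beta>: "\<beta> > 0"
  shows "(\<integral>\<^sup>+x. poisson_gamma_density m r \<beta> x * ennreal (x powr s) \<partial>lborel) =
      ennreal (\<beta> powr (- s) * Gamma (m + s) / Gamma m * kummer_1F1 (- s) m (- r))"
proof -
  define f where "f k = pochhammer (m + s) k / pochhammer m k * r ^ k / fact k" for k
  define C where "C = \<beta> powr (- s) * Gamma (m + s) / Gamma m * exp (- r)"
  have Gpos: "Gamma m > 0" "Gamma (m + s) > 0"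
    using m by (simp_all add: Gamma_real_pos)
  have nonpos_Int: "m \<notin> \<int>\<^sub>\<le>\<^sub>0" "m + s \<notin> \<int>\<^sub>\<le>\<^sub>0"
    using m by (auto elim!: nonpos_Ints_cases simp del: of_int_add)
  have "C \<ge> 0"
    using Gpos by (simp add: C_def)
  have f: "f k \<ge> 0" for k
    using m r by (simp add: f_def pochhammer_nonneg)
  have summable: "summable f"
    unfolding f_def by (rule summable_norm_cancel, rule summable_kummer_1F1[OF m(1)])
  have "(\<integral>\<^sup>+x. poisson_gamma_density m r \<beta> x * ennreal (x powr s) \<partial>lborel) =
    (\<integral>\<^sup>+x. (\<Sum>k. ennreal (r ^ k / fact k * exp (- r)) *
      (ennreal (gamma_density (m + real k) \<beta> x) * ennreal (x powr s))) \<partial>lborel)"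
    unfolding poisson_gamma_density_def by (simp add: mult.assoc flip: ennreal_suminf_multc)
  also have "\<dots> = (\<Sum>k. ennreal (r ^ k / fact k * exp (- r)) *
      (\<integral>\<^sup>+x. ennreal (gamma_density (m + real k) \<beta> x) * ennreal (x powr s) \<partial>lborel))"
    by (simp add: nn_integral_suminf nn_integral_cmult)
  also have "\<dots> = (\<Sum>k. ennreal (C * f k))"
  proof (rule suminf_cong)
    fix k
    have "Gamma (m + real k) = Gamma m * pochhammer m k"
      using Gpos pochhammer_Gamma[of m k, OF nonpos_Int(1)] by simp
    moreover have "Gamma (m + real k + s) = Gamma (m + s) * pochhammer (m + s) k"
      using Gpos pochhammer_Gamma[of "m + s" k, OF nonpos_Int(2)] by (simp add: add_ac)
    ultimately have "r ^ k / fact k * exp (- r) * (\<beta> powr (- s) * Gamma (m + real k + s) / Gamma (m + real k)) = C * f k"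
      by (simp add: C_def f_def mult_ac)
    moreover have "Gamma (m + real k + s) / Gamma (m + real k) > 0"
      using m by (simp add: Gamma_real_pos)
    ultimately show "ennreal (r ^ k / fact k * exp (- r)) *
        (\<integral>\<^sup>+x. ennreal (gamma_density (m + real k) \<beta> x) * ennreal (x powr s) \<partial>lborel) = ennreal (C * f k)"
      using m \<beta> r by (subst nn_integral_gamma_density_powr) (auto simp flip: ennreal_mult')
  qed
  also have "\<dots> = ennreal (C * suminf f)"
    using f \<open>C \<ge> 0\<close> summable by (subst suminf_ennreal2) (auto intro: summable_mult simp: suminf_mult)
  \<comment> \<open>Writing \<open>m + s\<close> as \<open>m - (- s)\<close> matches the left-hand
    side of \<open>kummer_transformation\<close> with \<open>a = - s\<close>.\<close>
  also have "C * suminf f = \<beta> powr (- s) * Gamma (m + s) / Gamma m * (exp (- r) * kummer_1F1 (m - (- s)) m r)"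
    by (simp add: C_def f_def[abs_def] kummer_1F1_altdef)
  finally show ?thesis
    by (simp only: kummer_transformation[OF m(1)])
qed

text \<open>The binomial theorem divided by \<open>fact n\<close>: independent Poisson variables add
  up to a Poisson variable.\<close>

lemma poisson_weights_convolution:
  fixes a b :: real
  shows "(\<Sum>i\<le>n. (a ^ i / fact i * exp (- a)) * (b ^ (n - i) / fact (n - i) * exp (- b))) =
    (a + b) ^ n / fact n * exp (- (a + b))"
proof -
  have "(a + b) ^ n / fact n = (\<Sum>i\<le>n. a ^ i / fact i * (b ^ (n - i) / fact (n - i)))"
    unfolding binomial_ring sum_divide_distrib
    by (intro sum.cong refl) (simp add: binomial_fact)
  moreover have "(\<Sum>i\<le>n. (a ^ i / fact i * exp (- a)) * (b ^ (n - i) / fact (n - i) * exp (- b))) =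
      (\<Sum>i\<le>n. a ^ i / fact i * (b ^ (n - i) / fact (n - i))) * (exp (- a) * exp (- b))"
    unfolding sum_distrib_right by (intro sum.cong refl) simp
  moreover have "exp (- a) * exp (- b) = exp (- (a + b))"
    by (simp flip: exp_add)
  ultimately show ?thesis
    by simp
qed

text \<open>The convolution of components \<open>i\<close> and \<open>j\<close> depends only on
  \<open>i + j\<close>. Summing along diagonals therefore leaves a convolution of Poisson
  weights.\<close>

lemma convolution_poisson_gamma_density:
  assumes m: "m\<^sub>1 > 0" "m\<^sub>2 > 0" and r: "r\<^sub>1 \<ge> 0" "r\<^sub>2 \<ge> 0" and \<beta>: "\<beta> > 0"
  shows "(\<integral>\<^sup>+y. poisson_gamma_density m\<^sub>1 r\<^sub>1 \<beta> (x - y) * poisson_gamma_density m\<^sub>2 r\<^sub>2 \<beta> y \<partial>lborel) =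
      poisson_gamma_density (m\<^sub>1 + m\<^sub>2) (r\<^sub>1 + r\<^sub>2) \<beta> x"
proof -
  define p where "p r k = r ^ k / fact k * exp (- r)" for r :: real and k :: nat
  have p: "p r\<^sub>1 k \<ge> 0" "p r\<^sub>2 k \<ge> 0" for k
    using r by (simp_all add: p_def)
  let ?G = "\<lambda>m x. ennreal (gamma_density m \<beta> x)"
  have "(\<integral>\<^sup>+y. poisson_gamma_density m\<^sub>1 r\<^sub>1 \<beta> (x - y) * poisson_gamma_density m\<^sub>2 r\<^sub>2 \<beta> y \<partial>lborel) =
    (\<integral>\<^sup>+y. (\<Sum>i. \<Sum>j. ennreal (p r\<^sub>1 i * p r\<^sub>2 j) * (?G (m\<^sub>1 + real i) (x - y) * ?G (m\<^sub>2 + real j) y)) \<partial>lborel)"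
    unfolding poisson_gamma_density_def p_def[symmetric]
    by (simp add: ennreal_mult p mult_ac flip: ennreal_suminf_multc ennreal_suminf_cmult)
  also have "\<dots> = (\<Sum>i. \<Sum>j. ennreal (p r\<^sub>1 i * p r\<^sub>2 j) *
      (\<integral>\<^sup>+y. ?G (m\<^sub>1 + real i) (x - y) * ?G (m\<^sub>2 + real j) y \<partial>lborel))"
    by (simp add: nn_integral_suminf nn_integral_cmult)
  also have "\<dots> = (\<Sum>i. \<Sum>j. ennreal (p r\<^sub>1 i * p r\<^sub>2 j) * ?G (m\<^sub>1 + m\<^sub>2 + real (i + j)) x)"
    using m \<beta> by (simp add: convolution_gamma_density add_ac)
  also have "\<dots> = (\<Sum>n. \<Sum>i\<le>n. ennreal (p r\<^sub>1 i * p r\<^sub>2 (n - i)) * ?G (m\<^sub>1 + m\<^sub>2 + real n) x)"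
    by (subst suminf_diagonals_ennreal) simp
  also have "\<dots> = (\<Sum>n. ennreal (\<Sum>i\<le>n. p r\<^sub>1 i * p r\<^sub>2 (n - i)) * ?G (m\<^sub>1 + m\<^sub>2 + real n) x)"
    by (simp add: p sum_ennreal flip: sum_distrib_right)
  also have "\<dots> = poisson_gamma_density (m\<^sub>1 + m\<^sub>2) (r\<^sub>1 + r\<^sub>2) \<beta> x"
    unfolding p_def poisson_weights_convolution poisson_gamma_density_def ..
  finally show ?thesis .
qed

section \<open>Random variables with Poisson-gamma distribution\<close>

context prob_space
begin

text \<open>The induction starts from a singleton, since the empty sum is the constant 0 and has no
  density.\<close>

lemma distributed_sum_poisson_gamma:
  assumes "finite I" "I \<noteq> {}" and "indep_vars (\<lambda>_. borel) X I"
    and "\<And>i. i \<in> I \<Longrightarrow> distributed M lborel (X i) (poisson_gamma_density (m i) (r i) \<beta>)"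
    and "\<And>i. i \<in> I \<Longrightarrow> m i > 0" "\<And>i. i \<in> I \<Longrightarrow> r i \<ge> 0" and "\<beta> > 0"
  shows "distributed M lborel (\<lambda>\<omega>. \<Sum>i\<in>I. X i \<omega>)
    (poisson_gamma_density (\<Sum>i\<in>I. m i) (\<Sum>i\<in>I. r i) \<beta>)"
  using assms
proof (induct rule: finite_ne_induct)
  case (singleton i)
  then show ?case by simp
next
  case (insert i I)
  have "indep_var borel (X i) borel (\<lambda>\<omega>. \<Sum>j\<in>I. X j \<omega>)"
    using insert by (intro indep_vars_sum) auto
  moreover have "distributed M lborel (X i) (poisson_gamma_density (m i) (r i) \<beta>)"
    using insert by simp
  moreover have "distributed M lborel (\<lambda>\<omega>. \<Sum>j\<in>I. X j \<omega>)
      (poisson_gamma_density (\<Sum>j\<in>I. m j) (\<Sum>j\<in>I. r j) \<beta>)"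
    using insert by (intro insert) (auto intro: indep_vars_subset)
  ultimately have "distributed M lborel (\<lambda>\<omega>. X i \<omega> + (\<Sum>j\<in>I. X j \<omega>))
      (\<lambda>x. \<integral>\<^sup>+y. poisson_gamma_density (m i) (r i) \<beta> (x - y) *
        poisson_gamma_density (\<Sum>j\<in>I. m j) (\<Sum>j\<in>I. r j) \<beta> y \<partial>lborel)"
    by (rule distributed_convolution)
  also have "(\<lambda>x. \<integral>\<^sup>+y. poisson_gamma_density (m i) (r i) \<beta> (x - y) *
        poisson_gamma_density (\<Sum>j\<in>I. m j) (\<Sum>j\<in>I. r j) \<beta> y \<partial>lborel) =
      poisson_gamma_density (m i + (\<Sum>j\<in>I. m j)) (r i + (\<Sum>j\<in>I. r j)) \<beta>"
    using insert by (intro ext convolution_poisson_gamma_density sum_pos sum_nonneg) auto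
  finally show ?case
    using insert by simp
qed

lemma has_bochner_integral_poisson_gamma_powr:
  assumes X: "distributed M lborel X (poisson_gamma_density m r \<beta>)"
    and m: "m > 0" "m + s > 0" and r: "r \<ge> 0" and \<beta>: "\<beta> > 0"
  shows "has_bochner_integral M (\<lambda>\<omega>. X \<omega> powr s)
    (\<beta> powr (- s) * Gamma (m + s) / Gamma m * kummer_1F1 (- s) m (- r))"
proof (rule has_bochner_integral_nn_integral)
  have [measurable]: "X \<in> borel_measurable M"
    using distributed_measurable[OF X] by simp
  show "(\<lambda>\<omega>. X \<omega> powr s) \<in> borel_measurable M"
    by measurable
  \<comment> \<open>The sign of \<open>kummer_1F1 (- s) m (- r)\<close> cannot be read off its
    series. Its Kummer transform has nonnegative terms only.\<close>
  have "0 \<le> (\<Sum>k. pochhammer (m + s) k / pochhammer m k * r ^ k / fact k)"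
    using m r by (intro suminf_nonneg summable_norm_cancel[OF summable_kummer_1F1])
      (auto simp: pochhammer_nonneg)
  then have "0 \<le> exp (- r) * kummer_1F1 (m - (- s)) m r"
    by (simp add: kummer_1F1_altdef)
  then have "0 \<le> kummer_1F1 (- s) m (- r)"
    by (simp only: kummer_transformation[OF m(1)])
  then show "0 \<le> \<beta> powr (- s) * Gamma (m + s) / Gamma m * kummer_1F1 (- s) m (- r)"
    using m by (simp add: Gamma_real_pos less_imp_le)
  show "(\<integral>\<^sup>+\<omega>. ennreal (X \<omega> powr s) \<partial>M) =
      ennreal (\<beta> powr (- s) * Gamma (m + s) / Gamma m * kummer_1F1 (- s) m (- r))"
    using distributed_nn_integral[OF X, of "\<lambda>x. ennreal (x powr s)"]
    by (simp add: nn_integral_poisson_gamma_density_powr[OF m r \<beta>])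
qed simp

text \<open>Positivity is known only almost surely, and splitting the square root of a quotient into
  powers relies on it.\<close>

lemma AE_poisson_gamma_pos:
  assumes "distributed M lborel X (poisson_gamma_density m r \<beta>)"
  shows "AE \<omega> in M. X \<omega> > 0"
proof (subst distributed_AE2[OF assms])
  show "AE x in lborel. 0 < poisson_gamma_density m r \<beta> x \<longrightarrow> 0 < x"
    by (metis (mono_tags) AE_I2 less_irrefl linorder_not_less poisson_gamma_density_nonpos)
qed simp

end

section \<open>The error vector magnitude\<close>

lemma powr_minus_half_mult_powr_half:
  fixes x y :: real
  assumes "x > 0" "y > 0"
  shows "y powr (- 1/2) * x powr (1/2) = sqrt (x / y)"
  using assms powr_minus_divide[of y "1/2"] by (simp add: powr_half_sqrt real_sqrt_divide)

theorem corollary2: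
  fixes M :: "'a measure" and L :: nat
    and gd :: "'a \<Rightarrow> real" and g :: "nat \<Rightarrow> 'a \<Rightarrow> real"
    and \<kappa> \<mu> \<kappa>\<^sub>I \<mu>\<^sub>I :: real
  assumes "prob_space M"
    and "L \<ge> 1"
    and "\<kappa> > 0" and "\<mu> > 0" and "\<kappa>\<^sub>I > 0" and "\<mu>\<^sub>I > 0"
    and "prob_space.indep_vars M (\<lambda>_. borel) (\<lambda>l. if l = 0 then gd else g l) {0..L}"
    and "kappa_mu_power_rv M gd \<kappa> \<mu>"
    and "\<And>l. l \<in> {1..L} \<Longrightarrow> kappa_mu_power_rv M (g l) \<kappa>\<^sub>I \<mu>\<^sub>I"
    and "\<mu> > 1 / 2"
  shows "integrable M (error_vector L gd g) \<and>
    EVM M L gd g =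
      Gamma (\<mu> - 1 / 2) * Gamma (real L * \<mu>\<^sub>I + 1 / 2) / (Gamma (real L * \<mu>\<^sub>I) * Gamma \<mu>)
      * kummer_1F1 (1 / 2) \<mu> (- \<kappa> * \<mu>)
      * kummer_1F1 (- 1 / 2) (real L * \<mu>\<^sub>I) (- real L * \<kappa>\<^sub>I * \<mu>\<^sub>I)
      * sqrt (\<mu> * (1 + \<kappa>) / (\<mu>\<^sub>I * (1 + \<kappa>\<^sub>I)))"
proof -
  interpret prob_space M by fact
  let ?X = "\<lambda>l. if l = 0 then gd else g l"
  \<comment> \<open>Summing the family \<open>?X\<close>, whose index 0 is the desired signal, keeps
    \<open>S\<close> in the form to which the independence assumption applies.\<close>
  define S where "S \<omega> = (\<Sum>l\<in>{1..L}. ?X l \<omega>)" for \<omega>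
  have S_eq: "S \<omega> = (\<Sum>l\<in>{1..L}. g l \<omega>)" for \<omega>
    unfolding S_def by (intro sum.cong) auto
  define \<beta> where "\<beta> = \<mu> * (1 + \<kappa>)"
  define \<beta>\<^sub>I where "\<beta>\<^sub>I = \<mu>\<^sub>I * (1 + \<kappa>\<^sub>I)"
  have pos: "\<beta> > 0" "\<beta>\<^sub>I > 0" "real L * \<mu>\<^sub>I > 0" "real L * (\<mu>\<^sub>I * \<kappa>\<^sub>I) \<ge> 0"
    using assms by (simp_all add: \<beta>_def \<beta>\<^sub>I_def)
  have gd: "distributed M lborel gd (poisson_gamma_density \<mu> (\<mu> * \<kappa>) \<beta>)"
    using assms by (simp add: kappa_mu_power_rv_def kappa_mu_power_density_conv_poisson_gamma \<beta>_def)
  have g: "distributed M lborel (g l) (poisson_gamma_density \<mu>\<^sub>I (\<mu>\<^sub>I * \<kappa>\<^sub>I) \<beta>\<^sub>I)" if "l \<in> {1..L}" for l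
    using assms(9)[OF that] assms by (simp add: kappa_mu_power_rv_def kappa_mu_power_density_conv_poisson_gamma \<beta>\<^sub>I_def)
  have "distributed M lborel S
      (poisson_gamma_density (\<Sum>l\<in>{1..L}. \<mu>\<^sub>I) (\<Sum>l\<in>{1..L}. \<mu>\<^sub>I * \<kappa>\<^sub>I) \<beta>\<^sub>I)"
    unfolding S_def
  proof (rule distributed_sum_poisson_gamma)
    show "indep_vars (\<lambda>_. borel) ?X {1..L}"
      by (rule indep_vars_subset[OF assms(7)]) auto
  qed (use assms g pos in auto)
  then have S: "distributed M lborel S (poisson_gamma_density (real L * \<mu>\<^sub>I) (real L * (\<mu>\<^sub>I * \<kappa>\<^sub>I)) \<beta>\<^sub>I)"
    by simp
  have "indep_var borel (?X 0) borel S"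
    unfolding S_def
  proof (rule indep_vars_sum)
    show "indep_vars (\<lambda>_. borel) ?X (insert 0 {1..L})"
      using assms(7) by (simp add: atLeast0_atMost_Suc_eq_insert_0 atLeastAtMost_insertL)
  qed auto
  then have "indep_var borel ((\<lambda>x. x powr (- 1/2)) \<circ> gd) borel ((\<lambda>x. x powr (1/2)) \<circ> S)"
    by (intro indep_var_compose) auto
  then have indep: "indep_var borel (\<lambda>\<omega>. gd \<omega> powr (- 1/2)) borel (\<lambda>\<omega>. S \<omega> powr (1/2))"
    by (simp add: o_def)
  \<comment> \<open>The moment of order \<open>- 1/2\<close> requires
    \<open>\<mu> - 1/2 > 0\<close>; this is where \<open>\<mu> > 1 / 2\<close> enters.\<close>
  have D: "has_bochner_integral M (\<lambda>\<omega>. gd \<omega> powr (- 1/2))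
      (\<beta> powr (1/2) * Gamma (\<mu> - 1/2) / Gamma \<mu> * kummer_1F1 (1/2) \<mu> (- (\<mu> * \<kappa>)))"
    using has_bochner_integral_poisson_gamma_powr[OF gd, of "- 1/2"] assms pos by simp
  have N: "has_bochner_integral M (\<lambda>\<omega>. S \<omega> powr (1/2))
      (\<beta>\<^sub>I powr (- 1/2) * Gamma (real L * \<mu>\<^sub>I + 1/2) / Gamma (real L * \<mu>\<^sub>I) *
        kummer_1F1 (- 1/2) (real L * \<mu>\<^sub>I) (- (real L * (\<mu>\<^sub>I * \<kappa>\<^sub>I))))"
    using has_bochner_integral_poisson_gamma_powr[OF S, of "1/2"] assms pos by simp
  have int: "integrable M (\<lambda>\<omega>. gd \<omega> powr (- 1/2) * S \<omega> powr (1/2))"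
    using indep D N by (intro indep_var_integrable) (auto simp: has_bochner_integral_iff)
  have exp: "expectation (\<lambda>\<omega>. gd \<omega> powr (- 1/2) * S \<omega> powr (1/2)) =
      expectation (\<lambda>\<omega>. gd \<omega> powr (- 1/2)) * expectation (\<lambda>\<omega>. S \<omega> powr (1/2))"
    using indep D N by (intro indep_var_lebesgue_integral) (auto simp: has_bochner_integral_iff)
  have [measurable]: "gd \<in> borel_measurable M" "S \<in> borel_measurable M"
    using distributed_measurable[OF gd] distributed_measurable[OF S] by simp_all
  have ev: "error_vector L gd g = (\<lambda>\<omega>. sqrt (S \<omega> / gd \<omega>))"
    by (auto simp: error_vector_def S_eq)
  have ae: "AE \<omega> in M. gd \<omega> powr (- 1/2) * S \<omega> powr (1/2) = error_vector L gd g \<omega>"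
    using AE_poisson_gamma_pos[OF gd] AE_poisson_gamma_pos[OF S]
    by eventually_elim (simp only: ev powr_minus_half_mult_powr_half)
  have meas: "error_vector L gd g \<in> borel_measurable M"
    unfolding ev by measurable
  have "integrable M (error_vector L gd g)"
    by (rule integrable_cong_AE_imp[OF int meas ae])
  moreover have "EVM M L gd g = expectation (\<lambda>\<omega>. gd \<omega> powr (- 1/2) * S \<omega> powr (1/2))"
    unfolding EVM_def using ae meas by (intro integral_cong_AE) auto
  \<comment> \<open>The rate factors of the two moments combine into the square root of the closed
    form.\<close>
  moreover have "\<beta>\<^sub>I powr (- 1/2) * \<beta> powr (1/2) = sqrt (\<beta> / \<beta>\<^sub>I)"
    using pos by (intro powr_minus_half_mult_powr_half)
  ultimately show ?thesis
    unfolding exp has_bochner_integral_integral_eq[OF D] has_bochner_integral_integral_eq[OF N]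
    by (simp add: \<beta>_def \<beta>\<^sub>I_def mult_ac)
qed

end
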